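(* Let $n\ge4$ and let $P_n$ be the path with $n$ vertices. Then \[\mathbf{X}_{P_n}=\sum_{\lambda=(1^{m_1}2^{m_2}\cdots n^{m_n})\vdash n}(-1)^{m_1}\binom{m_2+\cdots+m_n}{m_2,\dots,m_n}\binom{n-2-\ell(\lambda)+m_1}{m_1}\,\mathfrak{st}_\lambda.\]
   Context: The chromatic symmetric function of a finite simple graph $G$ with vertices $v_1,\dots,v_n$ is $\mathbf{X}_G=\sum_\kappa x_{\kappa(v_1)}\cdots x_{\kappa(v_n)}$, summed over all proper colorings $\kappa:V(G)\to\mathbb{N}$. The star graph $\mathsf{St}_k$ on $k$ vertices is the tree with one central vertex adjacent to $k-1$ leaves ($\mathsf{St}_1$ is a single vertex); $\mathfrak{st}_k:=\mathbf{X}_{\mathsf{St}_k}$, and $\mathfrak{st}_\lambda:=\mathfrak{st}_{\lambda_1}\mathfrak{st}_{\lambda_2}\cdots$ for a partition $\lambda$. The notation $\lambda=(1^{m_1}2^{m_2}\cdots n^{m_n})$ means $\lambda$ has exactly $m_i$ parts equal to $i$; $\ell(\lambda)$ is the number of parts. $\binom{m_2+\cdots+m_n}{m_2,\dots,m_n}=\frac{(m_2+\cdots+m_n)!}{m_2!\cdots m_n!}$ is the multinomial coefficient (equal to $1$ if all $m_i=0$), and $\binom ab=0$ for $b>a\ge0$. *)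

theory Defs
  imports "HOL-Library.Multiset" "HOL-Library.FuncSet" "Graph_Theory.Pair_Digraph"
begin

section \<open>Formal power series in infinitely many variables\<close>

text \<open>
  Formal power series in commuting variables \<open>x\<^sub>0, x\<^sub>1, x\<^sub>2, \<dots>\<close>. A monomial is identified with
  the multiset of indices of its variables, so that \<open>x\<^sub>0\<^sup>2 x\<^sub>3\<close> is \<open>{#0, 0, 3#}\<close>, the product of
  monomials is the sum of multisets and the monomial \<open>1\<close> is \<open>{#}\<close>.
\<close>

typedef 'a mfps = "UNIV :: (nat multiset \<Rightarrow> 'a) set"
  morphisms mfps_coeff Abs_mfps
  by simp

lemma mfps_coeff_Abs [simp]: "mfps_coeff (Abs_mfps f) = f"
  by (simp add: Abs_mfps_inverse)

lemma mfps_eqI: "(\<And>M. mfps_coeff f M = mfps_coeff g M) \<Longrightarrow> f = g"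
  by (simp add: mfps_coeff_inject [symmetric] fun_eq_iff)

definition msplits :: "nat multiset \<Rightarrow> (nat multiset \<times> nat multiset) set" where
  "msplits M = {(A, B). A + B = M}"

lemma finite_msplits [simp]: "finite (msplits M)"
proof (induction M)
  case empty
  have "msplits {#} = {({#}, {#})}" by (auto simp: msplits_def)
  then show ?case by simp
next
  case (add x M)
  have "msplits (add_mset x M) \<subseteq>
      (\<lambda>(A, B). (add_mset x A, B)) ` msplits M \<union> (\<lambda>(A, B). (A, add_mset x B)) ` msplits M"
  proof (rule subrelI)
    fix A B assume "(A, B) \<in> msplits (add_mset x M)"
    then have eq: "A + B = add_mset x M" by (simp add: msplits_def)
    then have "x \<in># A + B" by simp
    then consider "x \<in># A" | "x \<in># B" by auto
    then show "(A, B) \<in> (\<lambda>(A, B). (add_mset x A, B)) ` msplits M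
        \<union> (\<lambda>(A, B). (A, add_mset x B)) ` msplits M"
    proof cases
      case 1
      then obtain A' where "A = add_mset x A'" by (meson multi_member_split)
      with eq show ?thesis by (force simp: msplits_def)
    next
      case 2
      then obtain B' where "B = add_mset x B'" by (meson multi_member_split)
      with eq show ?thesis by (force simp: msplits_def)
    qed
  qed
  with add.IH show ?case by (meson finite_UnI finite_imageI finite_subset)
qed

instantiation mfps :: (comm_ring_1) comm_ring_1
begin

definition zero_mfps_def: "0 = Abs_mfps (\<lambda>_. 0)"
definition one_mfps_def: "1 = Abs_mfps (\<lambda>M. if M = {#} then 1 else 0)"
definition plus_mfps_def: "f + g = Abs_mfps (\<lambda>M. mfps_coeff f M + mfps_coeff g M)"
definition uminus_mfps_def: "- f = Abs_mfps (\<lambda>M. - mfps_coeff f M)"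
definition minus_mfps_def: "f - g = Abs_mfps (\<lambda>M. mfps_coeff f M - mfps_coeff g M)"
definition times_mfps_def:
  "f * g = Abs_mfps (\<lambda>M. \<Sum>(A, B)\<in>msplits M. mfps_coeff f A * mfps_coeff g B)"

instance
proof
  fix f g h :: "'a mfps"
  show "f * g * h = f * (g * h)"
  proof (rule mfps_eqI)
    fix M
    let ?f = "mfps_coeff f" and ?g = "mfps_coeff g" and ?h = "mfps_coeff h"
    have "mfps_coeff (f * g * h) M =
        (\<Sum>p\<in>msplits M. \<Sum>q\<in>msplits (fst p). ?f (fst q) * ?g (snd q) * ?h (snd p))"
      by (simp add: times_mfps_def sum_distrib_right case_prod_beta)
    also have "\<dots> = (\<Sum>(p, q)\<in>(SIGMA p:msplits M. msplits (fst p)).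
        ?f (fst q) * ?g (snd q) * ?h (snd p))"
      by (rule sum.Sigma) auto
    also have "\<dots> = (\<Sum>(p, q)\<in>(SIGMA p:msplits M. msplits (snd p)).
        ?f (fst p) * (?g (fst q) * ?h (snd q)))"
      by (rule sum.reindex_bij_witness
          [where i = "\<lambda>(p, q). ((fst p + fst q, snd q), (fst p, fst q))"
             and j = "\<lambda>(p, q). ((fst q, snd q + snd p), (snd q, snd p))"])
        (auto simp: msplits_def ac_simps)
    also have "\<dots> = (\<Sum>p\<in>msplits M. \<Sum>q\<in>msplits (snd p). ?f (fst p) * (?g (fst q) * ?h (snd q)))"
      by (rule sum.Sigma [symmetric]) auto
    also have "\<dots> = mfps_coeff (f * (g * h)) M"
      by (simp add: times_mfps_def sum_distrib_left case_prod_beta)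
    finally show "mfps_coeff (f * g * h) M = mfps_coeff (f * (g * h)) M" .
  qed
  show "f * g = g * f"
  proof (rule mfps_eqI)
    fix M
    show "mfps_coeff (f * g) M = mfps_coeff (g * f) M"
      unfolding times_mfps_def mfps_coeff_Abs
      by (rule sum.reindex_bij_witness [where i = prod.swap and j = prod.swap])
        (auto simp: msplits_def ac_simps)
  qed
  show "1 * f = f"
  proof (rule mfps_eqI)
    fix M
    have "mfps_coeff (1 * f) M =
        (\<Sum>(A, B)\<in>msplits M. (if A = {#} then 1 else 0) * mfps_coeff f B)"
      by (simp add: times_mfps_def one_mfps_def)
    also have "\<dots> = (\<Sum>(A, B)\<in>{({#} :: nat multiset, M)}. (if A = {#} then 1 else 0) * mfps_coeff f B)"
      by (rule sum.mono_neutral_right [OF finite_msplits])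
        (auto simp: msplits_def split: if_splits)
    finally show "mfps_coeff (1 * f) M = mfps_coeff f M" by simp
  qed
  show "(f + g) * h = f * h + g * h"
    by (rule mfps_eqI)
      (simp add: times_mfps_def plus_mfps_def distrib_right case_prod_beta sum.distrib)
  show "(0 :: 'a mfps) \<noteq> 1"
  proof
    assume "(0 :: 'a mfps) = 1"
    then have "mfps_coeff (0 :: 'a mfps) {#} = mfps_coeff 1 {#}" by simp
    then show False by (simp add: zero_mfps_def one_mfps_def)
  qed
qed (rule mfps_eqI; simp add: plus_mfps_def zero_mfps_def uminus_mfps_def minus_mfps_def ac_simps)+

end

section \<open>Chromatic symmetric functions\<close>

text \<open>
  Finite simple graphs are the \<^locale>\<open>pair_graph\<close>s: an undirected edge is represented by its two
  orientations. Colorings are taken extensional, so that distinct elements of the set are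
  distinct functions on the vertices; the color set is all of \<^typ>\<open>nat\<close>.
\<close>

definition proper_colorings :: "'v pair_pre_digraph \<Rightarrow> ('v \<Rightarrow> nat) set" where
  "proper_colorings G =
     {\<kappa> \<in> pverts G \<rightarrow>\<^sub>E UNIV. \<forall>(u, v)\<in>parcs G. \<kappa> u \<noteq> \<kappa> v}"

definition coloring_monomial :: "'v pair_pre_digraph \<Rightarrow> ('v \<Rightarrow> nat) \<Rightarrow> nat multiset" where
  "coloring_monomial G \<kappa> = image_mset \<kappa> (mset_set (pverts G))"

text \<open>
  The infinite sum of the monomials of all proper colorings is formed coefficientwise: the
  coefficient of a monomial is the number of proper colorings contributing it.
\<close>

definition chromatic_sym_fun :: "'v pair_pre_digraph \<Rightarrow> int mfps" where
  "chromatic_sym_fun G =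
     Abs_mfps (\<lambda>M. int (card {\<kappa> \<in> proper_colorings G. coloring_monomial G \<kappa> = M}))"

lemma finite_colorings_of_monomial:
  assumes "finite (pverts G)"
  shows "finite {\<kappa> \<in> proper_colorings G. coloring_monomial G \<kappa> = M}"
proof (rule finite_subset)
  show "{\<kappa> \<in> proper_colorings G. coloring_monomial G \<kappa> = M} \<subseteq> pverts G \<rightarrow>\<^sub>E set_mset M"
    using assms by (auto simp: proper_colorings_def coloring_monomial_def PiE_iff extensional_def)
  show "finite (pverts G \<rightarrow>\<^sub>E set_mset M)"
    using assms by (intro finite_PiE) auto
qed

definition path_graph :: "nat \<Rightarrow> nat pair_pre_digraph" where
  "path_graph n =
     \<lparr>pverts = {..<n}, parcs = {(i, j). i < n \<and> j < n \<and> (j = Suc i \<or> i = Suc j)}\<rparr>"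

text \<open>The center of the star is the vertex \<open>0\<close>.\<close>

definition star_graph :: "nat \<Rightarrow> nat pair_pre_digraph" where
  "star_graph k =
     \<lparr>pverts = {..<k}, parcs = {(i, j). i < k \<and> j < k \<and> (i = 0 \<and> j \<noteq> 0 \<or> i \<noteq> 0 \<and> j = 0)}\<rparr>"

lemma pair_graph_path_graph: "pair_graph (path_graph n)"
proof
  show "finite (parcs (path_graph n))"
    by (rule finite_subset [of _ "{..<n} \<times> {..<n}"]) (auto simp: path_graph_def)
qed (auto simp: path_graph_def symmetric_def arcs_ends_conv sym_def)

lemma pair_graph_star_graph: "pair_graph (star_graph k)"
proof
  show "finite (parcs (star_graph k))"
    by (rule finite_subset [of _ "{..<k} \<times> {..<k}"]) (auto simp: star_graph_def)
qed (auto simp: star_graph_def symmetric_def arcs_ends_conv sym_def)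

section \<open>Partitions and products of star functions\<close>

text \<open>
  A partition is the multiset of its (positive) parts, so the multiplicity \<open>m\<^sub>i\<close> is
  \<^term>\<open>count \<mu> i\<close> and the number of parts is \<^term>\<open>size \<mu>\<close>.
\<close>

definition partitions :: "nat \<Rightarrow> nat multiset set" where
  "partitions n = {\<mu>. 0 \<notin># \<mu> \<and> sum_mset \<mu> = n}"

lemma finite_partitions: "finite (partitions n)"
proof (rule finite_subset)
  have "size \<mu> \<le> sum_mset \<mu>" if "0 \<notin># \<mu>" for \<mu> :: "nat multiset"
    using that by (induction \<mu>) auto
  then show "partitions n \<subseteq> (\<Union>k\<le>n. multisets_of_size {..n} k)"
    by (auto simp: partitions_def multisets_of_size_def dest!: multi_member_split)
  show "finite (\<Union>k\<le>n. multisets_of_size {..n} k)"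
    by auto
qed

definition star_sym_fun :: "nat multiset \<Rightarrow> int mfps" where
  "star_sym_fun \<mu> = (\<Prod>k\<in>#\<mu>. chromatic_sym_fun (star_graph k))"

definition multinomial :: "(nat \<Rightarrow> nat) \<Rightarrow> nat set \<Rightarrow> nat" where
  "multinomial m I = fact (\<Sum>i\<in>I. m i) div (\<Prod>i\<in>I. fact (m i))"

text \<open>
  For \<open>n \<ge> 4\<close> the integer \<open>n - 2 - \<ell>(\<mu>) + m\<^sub>1\<close> is nonnegative for every partition of \<open>n\<close>, so it
  can be written in \<^typ>\<open>nat\<close> as \<^term>\<open>n + count \<mu> 1 - (2 + size \<mu>)\<close> without truncation.
\<close>

lemma binomial_top_nonneg:
  assumes "\<mu> \<in> partitions n" and "n \<ge> 4"
  shows "2 + size \<mu> \<le> n + count \<mu> 1"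
proof -
  have "2 * size \<mu> \<le> sum_mset \<mu> + count \<mu> 1" if "0 \<notin># \<mu>" for \<mu> :: "nat multiset"
    using that by (induction \<mu>) auto
  with assms show ?thesis by (force simp: partitions_def)
qed

end

theory Submission
  imports Defs "HOL-Combinatorics.Multiset_Permutations"
    "HOL-Computational_Algebra.Formal_Power_Series"
begin

text \<open>
  Splitting a coloring problem according to whether two vertices receive equal or different colors
  (deletion and contraction of an edge) relates paths and stars to the power sums \<open>p\<^sub>k\<close>. For the
  path series \<open>P(z)\<close> this gives \<open>P = 1 + Q P\<close> with \<open>Q(z) = \<Sum>\<^sub>k (-1)\<^sup>k\<^sup>-\<^sup>1 p\<^sub>k z\<^sup>k\<close>, and for the stars
  \<open>Q(z) = \<Sum>\<^sub>k st\<^sub>k u\<^sup>k\<close> with \<open>u = z / (1 + p\<^sub>1 z)\<close>. Since \<open>st\<^sub>1 = p\<^sub>1\<close>, multiplying by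
  \<open>1 + p\<^sub>1 z\<close> removes the term \<open>k = 1\<close>: \<open>P = (1 + p\<^sub>1 z) (1 + T(u) P)\<close> with
  \<open>T(u) = \<Sum>\<^sub>k\<^sub>\<ge>\<^sub>2 st\<^sub>k u\<^sup>k\<close>. Iterating this equation expands \<open>P\<close> over the sequences \<open>\<alpha>\<close> of parts
  at least \<open>2\<close>, each with the coefficient series \<open>st\<^sub>\<alpha> z\<^sup>|\<^sup>\<alpha>\<^sup>| (1 + p\<^sub>1 z)\<^sup>d\<close>, where
  \<open>d = 1 + \<ell>(\<alpha>) - |\<alpha>|\<close>. The rearrangements of \<open>\<alpha>\<close> account for the multinomial coefficient
  and the power of \<open>1 + p\<^sub>1 z\<close> for the binomial coefficient and the parts \<open>1\<close>.
\<close>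

unbundle fps_syntax

section \<open>Generating functions of weighted sets\<close>

text \<open>Since \<open>card\<close> is 0 on infinite sets, a monomial carried by infinitely many
  elements gets coefficient 0; the sum and product rules therefore assume finite fibres.\<close>

definition weight_gf :: "'a set \<Rightarrow> ('a \<Rightarrow> nat multiset) \<Rightarrow> int mfps" where
  "weight_gf S w = Abs_mfps (\<lambda>M. int (card {x \<in> S. w x = M}))"

lemma weight_gf_bij_betw:
  assumes "bij_betw f S T" and "\<And>x. x \<in> S \<Longrightarrow> v (f x) = w x"
  shows "weight_gf S w = weight_gf T v"
proof -
  have "card {x \<in> S. w x = M} = card {y \<in> T. v y = M}" for M
  proof (rule bij_betw_same_card)
    show "bij_betw f {x \<in> S. w x = M} {y \<in> T. v y = M}"
      using assms by (fastforce simp: bij_betw_def inj_on_def)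
  qed
  then show ?thesis by (simp add: weight_gf_def)
qed

lemma weight_gf_Un:
  assumes "S \<inter> T = {}" and "\<And>M. finite {x \<in> S \<union> T. w x = M}"
  shows "weight_gf (S \<union> T) w = weight_gf S w + weight_gf T w"
proof -
  have "card {x \<in> S \<union> T. w x = M} = card {x \<in> S. w x = M} + card {x \<in> T. w x = M}" for M
  proof (subst card_Un_disjoint [symmetric])
    show "finite {x \<in> S. w x = M}" "finite {x \<in> T. w x = M}"
      by (rule finite_subset [OF _ assms(2) [of M]]; blast)+
    show "{x \<in> S. w x = M} \<inter> {x \<in> T. w x = M} = {}" using assms(1) by blast
    show "card {x \<in> S \<union> T. w x = M} = card ({x \<in> S. w x = M} \<union> {x \<in> T. w x = M})"
      by (rule arg_cong [of _ _ card]) blast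
  qed
  then show ?thesis by (simp add: weight_gf_def plus_mfps_def)
qed

lemma weight_fibre_times:
  fixes v :: "'a \<Rightarrow> nat multiset"
  shows "{z \<in> S \<times> T. (case z of (x, y) \<Rightarrow> v x + w y) = M} =
    (\<Union>(A, B)\<in>msplits M. {x \<in> S. v x = A} \<times> {y \<in> T. w y = B})"
  by (auto simp: msplits_def)

lemma finite_pair_weight:
  fixes v :: "'a \<Rightarrow> nat multiset"
  assumes "\<And>M. finite {x \<in> S. v x = M}" and "\<And>M. finite {y \<in> T. w y = M}"
  shows "finite {z \<in> S \<times> T. (case z of (x, y) \<Rightarrow> v x + w y) = M}"
  unfolding weight_fibre_times using assms by auto

lemma weight_gf_times:
  assumes "\<And>M. finite {x \<in> S. v x = M}" and "\<And>M. finite {y \<in> T. w y = M}"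
  shows "weight_gf S v * weight_gf T w = weight_gf (S \<times> T) (\<lambda>(x, y). v x + w y)"
proof (rule mfps_eqI)
  fix M
  have "card {z \<in> S \<times> T. (case z of (x, y) \<Rightarrow> v x + w y) = M} =
      card (\<Union>(A, B)\<in>msplits M. {x \<in> S. v x = A} \<times> {y \<in> T. w y = B})"
    by (simp only: weight_fibre_times)
  also have "\<dots> = (\<Sum>(A, B)\<in>msplits M. card {x \<in> S. v x = A} * card {y \<in> T. w y = B})"
    by (subst card_UN_disjoint) (auto simp: assms card_cartesian_product case_prod_beta)
  finally show "mfps_coeff (weight_gf S v * weight_gf T w) M =
      mfps_coeff (weight_gf (S \<times> T) (\<lambda>(x, y). v x + w y)) M"
    by (simp add: weight_gf_def times_mfps_def case_prod_beta)
qed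

section \<open>Power sums and contraction at a root\<close>

definition power_sum :: "nat \<Rightarrow> int mfps" where
  "power_sum k = weight_gf UNIV (replicate_mset k)"

text \<open>Colorings of a graph with a distinguished vertex that is counted \<open>k\<close> times, as it results from
  contracting edges.\<close>

definition rooted_gf :: "nat \<Rightarrow> (nat \<times> nat list) set \<Rightarrow> int mfps" where
  "rooted_gf k S = weight_gf S (\<lambda>(c, ys). replicate_mset k c + mset ys)"

text \<open>A positive \<open>k\<close> forces the root color to occur in \<open>M\<close>; for
  \<open>k = 0\<close> the root would be free.\<close>

lemma finite_rooted_weight:
  assumes "k > 0"
  shows "finite {x \<in> S. (case x of (c, ys) \<Rightarrow> replicate_mset k c + mset ys) = M}"
proof (rule finite_subset)
  show "{x \<in> S. (case x of (c, ys) \<Rightarrow> replicate_mset k c + mset ys) = M} \<subseteq>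
      set_mset M \<times> {ys. set ys \<subseteq> set_mset M \<and> length ys \<le> size M}"
    using assms by auto
  show "finite (set_mset M \<times> {ys. set ys \<subseteq> set_mset M \<and> length ys \<le> size M})"
    by (intro finite_cartesian_product finite_lists_length_le) auto
qed

lemma finite_replicate_weight:
  assumes "k > 0"
  shows "finite {c \<in> S. replicate_mset k c = M}"
  by (rule finite_subset [of _ "set_mset M"]) (use assms in auto)

text \<open>A free vertex of multiplicity \<open>j\<close> gets color \<open>d\<close>. If
  \<open>d \<noteq> c\<close> it behaves like a neighbor of the root; if \<open>d = c\<close> it
  merges with the root and the multiplicities add.\<close>

lemma power_sum_times_rooted_gf:
  assumes "j > 0" and "k > 0"
  shows "power_sum j * rooted_gf k S =
    weight_gf {(d, c, ys). (c, ys) \<in> S \<and> d \<noteq> c}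
      (\<lambda>(d, c, ys). replicate_mset j d + replicate_mset k c + mset ys)
    + rooted_gf (j + k) S"
proof -
  let ?w = "\<lambda>(d, c, ys). replicate_mset j d + replicate_mset k c + mset ys"
  let ?N = "{(d, c, ys). (c, ys) \<in> S \<and> d \<noteq> c}" and ?E = "{(d, c, ys). (c, ys) \<in> S \<and> d = c}"
  note fin = finite_replicate_weight [OF \<open>j > 0\<close>] finite_rooted_weight [OF \<open>k > 0\<close>]
  have w: "(\<lambda>(x, y). replicate_mset j x + (case y of (c, ys) \<Rightarrow> replicate_mset k c + mset ys)) = ?w"
    by (auto simp: fun_eq_iff)
  have Un: "UNIV \<times> S = ?N \<union> ?E" by auto
  have "power_sum j * rooted_gf k S = weight_gf (UNIV \<times> S) ?w"
    unfolding power_sum_def rooted_gf_def by (subst weight_gf_times [OF fin]) (simp add: w)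
  also have "\<dots> = weight_gf ?N ?w + weight_gf ?E ?w"
    using finite_pair_weight [OF fin, of UNIV S] unfolding w Un
    by (intro weight_gf_Un) auto
  also have "weight_gf ?E ?w = rooted_gf (j + k) S"
    unfolding rooted_gf_def
    by (rule weight_gf_bij_betw [of snd])
      (auto simp: bij_betw_def inj_on_def image_iff intro!: multiset_eqI)
  finally show ?thesis .
qed

definition path_lists :: "nat \<Rightarrow> (nat \<times> nat list) set" where
  "path_lists n = {(c, ys). length ys = n \<and> successively (\<noteq>) (c # ys)}"

definition star_lists :: "nat \<Rightarrow> (nat \<times> nat list) set" where
  "star_lists n = {(c, ys). length ys = n \<and> c \<notin> set ys}"

text \<open>The extra vertex goes in front of the path and becomes the new root, of multiplicity
  \<open>k\<close>; equal colors contract the first edge.\<close>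

lemma rooted_gf_path_Suc:
  assumes "k > 0"
  shows "power_sum k * rooted_gf 1 (path_lists n) =
    rooted_gf k (path_lists (Suc n)) + rooted_gf (Suc k) (path_lists n)"
proof -
  have "weight_gf {(d, c, ys). (c, ys) \<in> path_lists n \<and> d \<noteq> c}
      (\<lambda>(d, c, ys). replicate_mset k d + replicate_mset 1 c + mset ys) =
    rooted_gf k (path_lists (Suc n))"
    unfolding rooted_gf_def
  proof (rule weight_gf_bij_betw)
    show "bij_betw (\<lambda>(d, c, ys). (d, c # ys))
        {(d, c, ys). (c, ys) \<in> path_lists n \<and> d \<noteq> c} (path_lists (Suc n))"
      by (rule bij_betw_byWitness [where f' = "\<lambda>(d, ys). (d, hd ys, tl ys)"])
        (auto simp: path_lists_def length_Suc_conv)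
  qed auto
  with power_sum_times_rooted_gf [of k 1 "path_lists n"] assms show ?thesis by simp
qed

text \<open>Here the extra vertex has multiplicity 1 and becomes a leaf, while the root keeps its
  multiplicity \<open>k\<close>.\<close>

lemma rooted_gf_star_Suc:
  assumes "k > 0"
  shows "power_sum 1 * rooted_gf k (star_lists n) =
    rooted_gf k (star_lists (Suc n)) + rooted_gf (Suc k) (star_lists n)"
proof -
  have "weight_gf {(d, c, ys). (c, ys) \<in> star_lists n \<and> d \<noteq> c}
      (\<lambda>(d, c, ys). replicate_mset 1 d + replicate_mset k c + mset ys) =
    rooted_gf k (star_lists (Suc n))"
    unfolding rooted_gf_def
  proof (rule weight_gf_bij_betw)
    show "bij_betw (\<lambda>(d, c, ys). (c, d # ys))
        {(d, c, ys). (c, ys) \<in> star_lists n \<and> d \<noteq> c} (star_lists (Suc n))"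
      by (rule bij_betw_byWitness [where f' = "\<lambda>(c, ys). (hd ys, c, tl ys)"])
        (auto simp: star_lists_def length_Suc_conv)
  qed auto
  with power_sum_times_rooted_gf [of 1 k "star_lists n"] assms show ?thesis by simp
qed

lemma rooted_gf_0:
  "rooted_gf k (path_lists 0) = power_sum k"
  "rooted_gf k (star_lists 0) = power_sum k"
  unfolding rooted_gf_def power_sum_def path_lists_def star_lists_def
  by (rule weight_gf_bij_betw [of fst]; force simp: bij_betw_def inj_on_def)+

section \<open>Colorings of paths and stars as lists of colors\<close>

lemma chromatic_sym_fun_eq_rooted_gf:
  assumes V: "pverts G = {..<Suc n}" and A: "parcs G \<subseteq> {..<Suc n} \<times> {..<Suc n}"
  shows "chromatic_sym_fun G =
    rooted_gf 1 {(c, ys). length ys = n \<and> (\<forall>(u, v)\<in>parcs G. (c # ys) ! u \<noteq> (c # ys) ! v)}"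
    (is "_ = rooted_gf 1 ?T")
proof -
  let ?f = "\<lambda>\<kappa>. (\<kappa> 0, map \<kappa> [1..<Suc n])"
  let ?g = "\<lambda>(c, ys). restrict (\<lambda>i. (c # ys) ! i) {..<Suc n}"
  have nth: "(\<kappa> 0 # map \<kappa> [1..<Suc n]) ! i = \<kappa> i" if "i < Suc n" for \<kappa> :: "nat \<Rightarrow> nat" and i
    using that by (cases i) (auto simp del: upt_Suc)
  have range: "u < Suc n" "v < Suc n" if "(u, v) \<in> parcs G" for u v
    using A that by auto
  have bij: "bij_betw ?f (proper_colorings G) ?T"
  proof (rule bij_betw_byWitness [where f' = ?g])
    show "\<forall>\<kappa>\<in>proper_colorings G. ?g (?f \<kappa>) = \<kappa>"
    proof
      fix \<kappa> assume "\<kappa> \<in> proper_colorings G"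
      then have "\<kappa> \<in> extensional {..<Suc n}"
        using V by (simp add: proper_colorings_def PiE_iff)
      then show "?g (?f \<kappa>) = \<kappa>"
        by (auto simp: restrict_def fun_eq_iff extensional_def nth simp del: upt_Suc One_nat_def)
    qed
    show "\<forall>x\<in>?T. ?f (?g x) = x"
      by (auto intro!: nth_equalityI simp del: upt_Suc)
    show "?f ` proper_colorings G \<subseteq> ?T"
    proof (rule image_subsetI)
      fix \<kappa> assume "\<kappa> \<in> proper_colorings G"
      then have "\<forall>(u, v)\<in>parcs G. \<kappa> u \<noteq> \<kappa> v" by (simp add: proper_colorings_def)
      then show "?f \<kappa> \<in> ?T"
        using range by (auto simp: nth simp del: upt_Suc One_nat_def)
    qed
    show "?g ` ?T \<subseteq> proper_colorings G"
      using V by (fastforce simp: proper_colorings_def dest: range)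
  qed
  have "[0..<Suc n] = 0 # [1..<Suc n]" by (simp add: upt_rec)
  then have "mset_set {..<Suc n} = mset (0 # [1..<Suc n])"
    by (metis mset_upt atLeast0LessThan)
  then have "replicate_mset 1 (\<kappa> 0) + mset (map \<kappa> [1..<Suc n]) = coloring_monomial G \<kappa>" for \<kappa>
    by (simp add: coloring_monomial_def V del: upt_Suc)
  then have "weight_gf (proper_colorings G) (coloring_monomial G) = rooted_gf 1 ?T"
    unfolding rooted_gf_def by (intro weight_gf_bij_betw [OF bij]) (simp del: upt_Suc)
  then show ?thesis by (simp add: chromatic_sym_fun_def weight_gf_def)
qed

lemma chromatic_path_graph_Suc:
  "chromatic_sym_fun (path_graph (Suc n)) = rooted_gf 1 (path_lists n)"
proof -
  have "successively (\<noteq>) xs \<longleftrightarrow> (\<forall>(u, v)\<in>parcs (path_graph (length xs)). xs ! u \<noteq> xs ! v)"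
    for xs :: "nat list"
    by (fastforce simp: successively_conv_nth path_graph_def)
  then have "path_lists n = {(c, ys). length ys = n \<and>
      (\<forall>(u, v)\<in>parcs (path_graph (Suc n)). (c # ys) ! u \<noteq> (c # ys) ! v)}"
    by (auto simp only: path_lists_def length_Cons)
  then show ?thesis
    by (simp only:) (rule chromatic_sym_fun_eq_rooted_gf; auto simp: path_graph_def)
qed

lemma chromatic_star_graph_Suc:
  "chromatic_sym_fun (star_graph (Suc n)) = rooted_gf 1 (star_lists n)"
proof -
  have "(c \<notin> set ys) \<longleftrightarrow> (\<forall>(u, v)\<in>parcs (star_graph (Suc (length ys))). (c # ys) ! u \<noteq> (c # ys) ! v)"
    for c :: nat and ys
  proof
    assume "c \<notin> set ys"
    then show "\<forall>(u, v)\<in>parcs (star_graph (Suc (length ys))). (c # ys) ! u \<noteq> (c # ys) ! v"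
      by (auto simp: star_graph_def nth_Cons in_set_conv_nth split: nat.splits)
  next
    assume *: "\<forall>(u, v)\<in>parcs (star_graph (Suc (length ys))). (c # ys) ! u \<noteq> (c # ys) ! v"
    have "ys ! i \<noteq> c" if "i < length ys" for i
      using * that by (force simp: star_graph_def)
    then show "c \<notin> set ys" by (auto simp: in_set_conv_nth)
  qed
  then have "star_lists n = {(c, ys). length ys = n \<and>
      (\<forall>(u, v)\<in>parcs (star_graph (Suc n)). (c # ys) ! u \<noteq> (c # ys) ! v)}"
    unfolding star_lists_def by auto
  then show ?thesis
    by (simp only:) (rule chromatic_sym_fun_eq_rooted_gf; auto simp: star_graph_def)
qed

lemma chromatic_path_graph_0: "chromatic_sym_fun (path_graph 0) = 1"
proof -
  \<comment> \<open>The constant \<open>undefined\<close> is the only extensional function on the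
    empty vertex set.\<close>
  have "proper_colorings (path_graph 0) = {\<lambda>_. undefined}"
    by (auto simp: proper_colorings_def path_graph_def)
  then show ?thesis
    by (auto simp: chromatic_sym_fun_def one_mfps_def coloring_monomial_def path_graph_def
        intro!: arg_cong [of _ _ Abs_mfps])
qed

section \<open>Unrolling the contraction recursions\<close>

lemma path_power_sum_expansion:
  assumes "k > 0"
  shows "rooted_gf k (path_lists n) =
    (\<Sum>j\<le>n. (- 1) ^ j * power_sum (k + j) * chromatic_sym_fun (path_graph (n - j)))"
  using assms
\<comment> \<open>Each contraction raises the root multiplicity by one and flips the sign, so
  \<open>k\<close> must vary.\<close>
proof (induction n arbitrary: k)
  case 0
  then show ?case by (simp add: rooted_gf_0 chromatic_path_graph_0)
next
  case (Suc n)
  have "rooted_gf k (path_lists (Suc n)) =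
      power_sum k * chromatic_sym_fun (path_graph (Suc n)) - rooted_gf (Suc k) (path_lists n)"
    using rooted_gf_path_Suc [of k n] Suc.prems by (simp add: chromatic_path_graph_Suc)
  also have "\<dots> = power_sum k * chromatic_sym_fun (path_graph (Suc n)) -
      (\<Sum>j\<le>n. (- 1) ^ j * power_sum (Suc k + j) * chromatic_sym_fun (path_graph (n - j)))"
    by (simp add: Suc.IH)
  also have "\<dots> = (\<Sum>j\<le>Suc n. (- 1) ^ j * power_sum (k + j)
      * chromatic_sym_fun (path_graph (Suc n - j)))"
    by (subst sum.atMost_Suc_shift) (simp add: sum_negf)
  finally show ?case .
qed

text \<open>With \<open>E\<close> the shift of \<open>n\<close> to \<open>n + 1\<close>,
  \<open>rooted_gf_star_Suc\<close> says that raising the root multiplicity by one, with a sign,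
  acts as \<open>E - power_sum 1\<close>. The right side is the binomial expansion of the
  \<open>j\<close>-th power of this operator.\<close>

lemma star_contraction:
  "(- 1) ^ j * rooted_gf (Suc j) (star_lists n) =
    (\<Sum>i\<le>j. of_nat (j choose i) * (- power_sum 1) ^ (j - i)
      * chromatic_sym_fun (star_graph (Suc (n + i))))"
proof (induction j arbitrary: n)
  case 0
  then show ?case by (simp add: chromatic_star_graph_Suc)
next
  case (Suc j)
  let ?s = "\<lambda>i. chromatic_sym_fun (star_graph (Suc (n + i)))"
  let ?x = "- power_sum 1"
  have step: "rooted_gf (Suc (Suc j)) (star_lists n) =
      power_sum 1 * rooted_gf (Suc j) (star_lists n) - rooted_gf (Suc j) (star_lists (Suc n))"
    using rooted_gf_star_Suc [of "Suc j" n] by (simp add: algebra_simps)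
  have "(- 1) ^ Suc j * rooted_gf (Suc (Suc j)) (star_lists n) =
      ?x * ((- 1) ^ j * rooted_gf (Suc j) (star_lists n))
      + (- 1) ^ j * rooted_gf (Suc j) (star_lists (Suc n))"
    unfolding step by (simp add: algebra_simps)
  also have "\<dots> = (\<Sum>i\<le>j. of_nat (j choose i) * ?x ^ (Suc j - i) * ?s i)
      + (\<Sum>i\<le>j. of_nat (j choose i) * ?x ^ (j - i) * ?s (Suc i))"
    unfolding Suc.IH
    by (simp add: sum_distrib_left Suc_diff_le mult_ac)
  \<comment> \<open>The added term \<open>i = Suc j\<close> is 0; it aligns the indices for Pascal's
    rule.\<close>
  also have "(\<Sum>i\<le>j. of_nat (j choose i) * ?x ^ (Suc j - i) * ?s i) =
      (\<Sum>i\<le>Suc j. of_nat (j choose i) * ?x ^ (Suc j - i) * ?s i)"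
    by (simp add: binomial_eq_0)
  also have "\<dots> = ?x ^ Suc j * ?s 0
      + (\<Sum>i\<le>j. of_nat (j choose Suc i) * ?x ^ (j - i) * ?s (Suc i))"
    by (subst sum.atMost_Suc_shift) simp
  also have "\<dots> + (\<Sum>i\<le>j. of_nat (j choose i) * ?x ^ (j - i) * ?s (Suc i)) =
      ?x ^ Suc j * ?s 0 + (\<Sum>i\<le>j. of_nat (Suc j choose Suc i) * ?x ^ (j - i) * ?s (Suc i))"
    by (simp add: sum.distrib algebra_simps)
  also have "\<dots> = (\<Sum>i\<le>Suc j. of_nat (Suc j choose i) * ?x ^ (Suc j - i) * ?s i)"
    unfolding sum.atMost_Suc_shift [of _ j] by simp
  finally show ?case .
qed

section \<open>Expansion over compositions\<close>

definition geometric_fps :: "'a::comm_ring_1 \<Rightarrow> 'a fps" where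
  "geometric_fps x = Abs_fps (\<lambda>m. x ^ m)"

lemma geometric_fps_inverse: "(1 - fps_const x * fps_X) * geometric_fps x = 1"
proof (rule fps_ext)
  fix n
  show "((1 - fps_const x * fps_X) * geometric_fps x) $ n = 1 $ n"
    by (cases n) (simp_all add: geometric_fps_def left_diff_distrib mult.assoc)
qed

text \<open>One more geometric factor sums the coefficients up to \<open>m\<close>, and the
  hockey-stick identity evaluates that sum.\<close>

lemma geometric_fps_power_nth:
  "(geometric_fps x ^ Suc d) $ m = of_nat ((d + m) choose m) * x ^ m"
proof (induction d arbitrary: m)
  case 0
  then show ?case by (simp add: geometric_fps_def)
next
  case (Suc d)
  have "(geometric_fps x ^ Suc (Suc d)) $ m =
      (\<Sum>i=0..m. of_nat ((d + i) choose i) * x ^ i * x ^ (m - i))"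
    by (subst power_Suc2) (simp only: fps_mult_nth Suc.IH, simp add: geometric_fps_def)
  also have "\<dots> = (\<Sum>i\<le>m. of_nat ((d + i) choose i)) * x ^ m"
    by (simp add: sum_distrib_right mult.assoc atLeast0AtMost flip: power_add)
  also have "\<dots> = of_nat ((Suc d + m) choose m) * x ^ m"
    using sum_choose_lower [of d m] by (simp flip: of_nat_sum)
  finally show ?case .
qed

text \<open>The sum is only bounded by \<open>n\<close>: the deficit
  \<open>n - sum_list \<alpha>\<close> is later filled with parts 1.\<close>

definition bounded_lists :: "nat \<Rightarrow> nat list set" where
  "bounded_lists n = {\<alpha>. (\<forall>i\<in>set \<alpha>. 2 \<le> i) \<and> sum_list \<alpha> \<le> n}"

lemma bounded_lists_rec:
  "bounded_lists n = insert [] (\<Union>i\<in>{2..n}. (#) i ` bounded_lists (n - i))"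
proof (intro set_eqI)
  fix \<alpha>
  show "\<alpha> \<in> bounded_lists n \<longleftrightarrow> \<alpha> \<in> insert [] (\<Union>i\<in>{2..n}. (#) i ` bounded_lists (n - i))"
    by (cases \<alpha>) (auto simp: bounded_lists_def image_iff)
qed

lemma finite_bounded_lists [simp]: "finite (bounded_lists n)"
proof (induction n rule: less_induct)
  case (less n)
  show ?case by (subst bounded_lists_rec) (auto intro!: less)
qed

lemma sum_bounded_lists_rec:
  "sum h (bounded_lists n) = h [] + (\<Sum>i=2..n. \<Sum>\<beta>\<in>bounded_lists (n - i). h (i # \<beta>))"
proof -
  have "sum h (bounded_lists n) = h [] + sum h (\<Union>i\<in>{2..n}. (#) i ` bounded_lists (n - i))"
    by (subst bounded_lists_rec) (auto intro!: sum.insert)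
  also have "sum h (\<Union>i\<in>{2..n}. (#) i ` bounded_lists (n - i)) =
      (\<Sum>i=2..n. sum h ((#) i ` bounded_lists (n - i)))"
    by (rule sum.UNION_disjoint) auto
  also have "\<dots> = (\<Sum>i=2..n. \<Sum>\<beta>\<in>bounded_lists (n - i). h (i # \<beta>))"
    by (simp add: sum.reindex)
  finally show ?thesis .
qed

text \<open>Unrolling \<open>P = Y + D P\<close> with \<open>D = \<Sum>\<^sub>i s\<^sub>i X\<^sup>i V\<^sup>i\<^sup>-\<^sup>1\<close>; the multiplier \<open>Z\<close> collects the
  powers of \<open>V\<close> already split off.\<close>

lemma fps_fixpoint_expansion:
  fixes P V Y D Z :: "'a::comm_ring_1 fps"
  assumes P: "P = Y + D * P"
    and D: "\<And>k. D $ k = (\<Sum>i=2..k. s i * (V ^ (i - 1)) $ (k - i))"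
  shows "(Z * P) $ n = (\<Sum>\<alpha>\<in>bounded_lists n.
    prod_list (map s \<alpha>) * (Z * Y * V ^ (\<Sum>i\<leftarrow>\<alpha>. i - 1)) $ (n - sum_list \<alpha>))"
proof (induction n arbitrary: Z rule: less_induct)
  case (less n)
  let ?h = "\<lambda>\<alpha>. prod_list (map s \<alpha>) * (Z * Y * V ^ (\<Sum>i\<leftarrow>\<alpha>. i - 1)) $ (n - sum_list \<alpha>)"
  \<comment> \<open>A finite truncation of \<open>D\<close>, equal to it up to degree
    \<open>n\<close>, which is all that the coefficient at \<open>n\<close> sees.\<close>
  let ?R = "\<Sum>i=2..n. fps_const (s i) * (fps_X ^ i * V ^ (i - 1))"
  have R: "D $ k = ?R $ k" if "k \<le> n" for k
  proof -
    have "?R $ k = (\<Sum>i=2..n. if k < i then 0 else s i * (V ^ (i - 1)) $ (k - i))"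
      by (auto simp: fps_sum_nth fps_X_power_mult_nth intro!: sum.cong)
    also have "\<dots> = (\<Sum>i=2..k. s i * (V ^ (i - 1)) $ (k - i))"
      by (rule sum.mono_neutral_cong_right) (use that in auto)
    finally show ?thesis by (simp add: D)
  qed
  have "(Z * P) $ n = (Z * Y) $ n + (D * (Z * P)) $ n"
    by (subst P) (simp add: algebra_simps)
  also have "(D * (Z * P)) $ n = (?R * (Z * P)) $ n"
    by (simp add: fps_mult_nth R)
  also have "\<dots> = (\<Sum>i=2..n. s i * (fps_X ^ i * (V ^ (i - 1) * Z * P)) $ n)"
    by (simp add: sum_distrib_right fps_sum_nth mult.assoc)
  also have "\<dots> = (\<Sum>i=2..n. s i * (V ^ (i - 1) * Z * P) $ (n - i))"
    by (rule sum.cong) (auto simp: fps_X_power_mult_nth)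
  \<comment> \<open>The induction hypothesis is applied at \<open>n - i\<close> with the multiplier
    \<open>V ^ (i - 1) * Z\<close>.\<close>
  also have "\<dots> = (\<Sum>i=2..n. \<Sum>\<beta>\<in>bounded_lists (n - i). ?h (i # \<beta>))"
    by (intro sum.cong refl, subst less)
      (auto simp only: atLeastAtMost_iff sum_distrib_left list.map prod_list.Cons sum_list.Cons
        power_add diff_diff_left mult_ac)
  also have "(Z * Y) $ n + \<dots> = sum ?h (bounded_lists n)"
    unfolding sum_bounded_lists_rec [of ?h] by simp
  finally show ?case .
qed

section \<open>The functional equation of the path series\<close>

definition path_fps :: "int mfps fps" where
  "path_fps = Abs_fps (\<lambda>n. chromatic_sym_fun (path_graph n))"

text \<open>This is \<open>(1 + p_1 z) T(u)\<close>: its terms are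
  \<open>st_i z^i (1 + p_1 z)^(1-i)\<close>, and the geometric series is the inverse of
  \<open>1 + p_1 z\<close>.\<close>

definition star_fps :: "int mfps fps" where
  "star_fps = Abs_fps (\<lambda>k. \<Sum>i=2..k. chromatic_sym_fun (star_graph i)
     * (geometric_fps (- power_sum 1) ^ (i - 1)) $ (k - i))"

text \<open>The binomial coefficients in the geometric powers are those of
  \<open>star_contraction\<close> for a single leaf, so the sum over stars collapses to a rooted
  edge.\<close>

lemma star_fps_nth:
  "star_fps $ 0 = 0" "star_fps $ Suc 0 = 0"
  "star_fps $ Suc (Suc j) = (- 1) ^ j * rooted_gf (Suc j) (star_lists 1)"
proof -
  let ?s = "\<lambda>i. chromatic_sym_fun (star_graph i)"
  have "star_fps $ Suc (Suc j) = (\<Sum>i=0+2..j+2. ?s i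
      * (geometric_fps (- power_sum 1) ^ (i - 1)) $ (j + 2 - i))"
    by (simp add: star_fps_def numeral_2_eq_2 del: sum.cl_ivl_Suc)
  also have "\<dots> = (\<Sum>i\<le>j. ?s (i + 2) * (geometric_fps (- power_sum 1) ^ Suc i) $ (j - i))"
    by (subst sum.shift_bounds_cl_nat_ivl) (simp add: atLeast0AtMost)
  also have "\<dots> = (\<Sum>i\<le>j. of_nat (j choose i) * (- power_sum 1) ^ (j - i) * ?s (Suc (1 + i)))"
    by (rule sum.cong)
      (auto simp only: geometric_fps_power_nth, auto simp: binomial_symmetric [symmetric] mult_ac)
  finally show "star_fps $ Suc (Suc j) = (- 1) ^ j * rooted_gf (Suc j) (star_lists 1)"
    by (simp add: star_contraction)
qed (simp_all add: star_fps_def)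

lemma path_fps_fixpoint:
  "path_fps = (1 - fps_const (- power_sum 1) * fps_X) + star_fps * path_fps"
proof -
  \<comment> \<open>Shifted by one degree: \<open>fps_X * Q\<close> is the alternating power sum
    series without constant term.\<close>
  define Q where "Q = Abs_fps (\<lambda>j. (- 1) ^ j * power_sum (Suc j))"
  let ?Y = "1 - fps_const (- power_sum 1) * fps_X"
  have P: "path_fps = 1 + fps_X * Q * path_fps"
  proof (rule fps_ext)
    fix n
    show "path_fps $ n = (1 + fps_X * Q * path_fps) $ n"
    proof (cases n)
      case 0
      then show ?thesis by (simp add: path_fps_def chromatic_path_graph_0)
    next
      case (Suc n')
      have "chromatic_sym_fun (path_graph (Suc n')) = (Q * path_fps) $ n'"
        using path_power_sum_expansion [of 1 n']
        by (simp add: chromatic_path_graph_Suc fps_mult_nth path_fps_def Q_def atLeast0AtMost)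
      then show ?thesis by (simp add: Suc path_fps_def mult.assoc)
    qed
  qed
  \<comment> \<open>Up to degree 1 only \<open>p_1 z\<close> is left; from degree 2 on, contracting
    the single edge in \<open>star_lists 1\<close> matches the coefficients.\<close>
  have Q: "?Y * (fps_X * Q) = star_fps + fps_const (power_sum 1) * fps_X"
  proof (rule fps_ext)
    fix n
    have Y: "(?Y * (fps_X * Q)) $ Suc m = Q $ m + power_sum 1 * (fps_X * Q) $ m" for m
      by (simp add: left_diff_distrib mult.assoc)
    consider "n = 0" | "n = 1" | j where "n = Suc (Suc j)"
      by (metis One_nat_def not0_implies_Suc)
    then show "(?Y * (fps_X * Q)) $ n = (star_fps + fps_const (power_sum 1) * fps_X) $ n"
    proof cases
      case 1
      then show ?thesis by (simp add: star_fps_nth)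
    next
      case 2
      then show ?thesis unfolding 2 One_nat_def Y by (simp add: star_fps_nth Q_def)
    next
      case 3
      have "power_sum 1 * power_sum (Suc j) =
          rooted_gf (Suc j) (star_lists 1) + power_sum (Suc (Suc j))"
        using rooted_gf_star_Suc [of "Suc j" 0] by (simp add: rooted_gf_0)
      then have "star_fps $ n =
          (- 1) ^ j * (power_sum 1 * power_sum (Suc j) - power_sum (Suc (Suc j)))"
        by (simp add: 3 star_fps_nth)
      then show ?thesis unfolding 3 Y by (simp add: Q_def algebra_simps)
    qed
  qed
  have "?Y * path_fps = ?Y + ?Y * (fps_X * Q) * path_fps"
    by (subst P) (simp only: distrib_left mult_1_right mult.assoc)
  then have "?Y * path_fps = ?Y + star_fps * path_fps + fps_const (power_sum 1) * fps_X * path_fps"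
    unfolding Q by (simp add: distrib_right)
  \<comment> \<open>As \<open>?Y\<close> is \<open>1 + p_1 z\<close>, the term
    \<open>p_1 z P\<close> cancels on both sides.\<close>
  then show ?thesis by (simp add: algebra_simps flip: fps_const_neg)
qed

section \<open>Binomial and multinomial coefficients\<close>

lemma length_mult_le_sum_list:
  assumes "\<forall>i\<in>set \<alpha>. k \<le> (i :: nat)"
  shows "k * length \<alpha> \<le> sum_list \<alpha>"
  using assms by (induction \<alpha>) auto

lemma sum_list_diff_one:
  assumes "\<forall>i\<in>set \<alpha>. 1 \<le> (i :: nat)"
  shows "(\<Sum>i\<leftarrow>\<alpha>. i - 1) + length \<alpha> = sum_list \<alpha>"
  using assms by (induction \<alpha>) auto

text \<open>Let \<open>d = sum_list \<alpha> - length \<alpha>\<close>. For \<open>d \<ge> 2\<close>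
  cancelling one factor leaves the geometric power \<open>d - 1\<close>, and
  \<open>d - 2 + m = n - 2 - length \<alpha>\<close>. For \<open>d \<le> 1\<close> both sides are 0:
  \<open>n \<ge> 4\<close> puts \<open>m\<close> above the degree of the remaining polynomial, and
  the binomial has its top below \<open>m\<close>.\<close>

lemma geometric_coefficient:
  assumes "n \<ge> 4" and \<alpha>: "\<alpha> \<in> bounded_lists n" and m: "m = n - sum_list \<alpha>"
  shows "((1 - fps_const x * fps_X) * geometric_fps x ^ (\<Sum>i\<leftarrow>\<alpha>. i - 1)) $ m =
    of_nat ((n - (2 + length \<alpha>)) choose m) * x ^ m"
proof -
  have parts: "\<forall>i\<in>set \<alpha>. 2 \<le> i" and le: "sum_list \<alpha> \<le> n"
    using \<alpha> by (auto simp: bounded_lists_def)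
  define d where "d = (\<Sum>i\<leftarrow>\<alpha>. i - 1)"
  have d: "d + length \<alpha> = sum_list \<alpha>"
    unfolding d_def using parts by (intro sum_list_diff_one) auto
  have len: "2 * length \<alpha> \<le> sum_list \<alpha>"
    using parts by (rule length_mult_le_sum_list)
  consider "d = 0" | "d = 1" | e where "d = Suc (Suc e)"
    by (metis One_nat_def not0_implies_Suc)
  then have "((1 - fps_const x * fps_X) * geometric_fps x ^ d) $ m =
    of_nat ((n - (2 + length \<alpha>)) choose m) * x ^ m"
  proof cases
    case 1
    \<comment> \<open>Parts are at least 2, so \<open>length \<alpha> \<le> d\<close>: here
      \<open>\<alpha>\<close> is empty, and for \<open>d = 1\<close> it is
      \<open>[2]\<close>.\<close>
    with d len have "length \<alpha> = 0" "sum_list \<alpha> = 0" by linarith+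
    then have "m = n" by (auto simp: m)
    with 1 \<open>length \<alpha> = 0\<close> \<open>n \<ge> 4\<close> show ?thesis by (simp add: binomial_eq_0)
  next
    case 2
    with d len have "length \<alpha> \<le> 1" by simp
    moreover have "length \<alpha> \<noteq> 0" using 2 d by auto
    ultimately have "length \<alpha> = 1" by linarith
    with 2 d \<open>n \<ge> 4\<close> have "m = n - 2" "n - (2 + length \<alpha>) < m" "m > 0" by (auto simp: m)
    with 2 show ?thesis by (simp add: binomial_eq_0 geometric_fps_inverse)
  next
    case 3
    have "(1 - fps_const x * fps_X) * geometric_fps x ^ d = geometric_fps x ^ Suc e"
      using geometric_fps_inverse [of x] by (simp add: 3 flip: mult.assoc)
    moreover have "n - (2 + length \<alpha>) = e + m"
      using 3 d le by (simp add: m)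
    ultimately show ?thesis by (simp only: geometric_fps_power_nth)
  qed
  then show ?thesis by (simp add: d_def)
qed

text \<open>Absent values contribute \<open>fact 0 = 1\<close>, so only the parts that occur count,
  as in the number of rearrangements.\<close>

lemma multinomial_eq_card_permutations:
  assumes "\<mu> \<in> partitions n"
  shows "multinomial (count \<mu>) {2..n} = card (permutations_of_multiset (filter_mset (\<lambda>i. i \<noteq> 1) \<mu>))"
proof -
  let ?\<nu> = "filter_mset (\<lambda>i. i \<noteq> 1) \<mu>"
  have sub: "set_mset ?\<nu> \<subseteq> {2..n}"
  proof
    fix i assume i: "i \<in># ?\<nu>"
    then have "i \<noteq> 0" "i \<noteq> 1" using assms by (auto simp: partitions_def intro: gr0I)
    moreover have "i \<le> n" using i assms by (auto simp: partitions_def dest!: multi_member_split)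
    ultimately show "i \<in> {2..n}" by auto
  qed
  have "(\<Sum>i=2..n. count \<mu> i) = (\<Sum>i=2..n. count ?\<nu> i)"
    by (rule sum.cong) auto
  also have "\<dots> = size ?\<nu>"
    unfolding size_multiset_overloaded_eq
    by (rule sum.mono_neutral_right) (use sub in \<open>auto simp: not_in_iff\<close>)
  finally have "(\<Sum>i=2..n. count \<mu> i) = size ?\<nu>" .
  moreover have "(\<Prod>i=2..n. fact (count \<mu> i)) = (\<Prod>i=2..n. fact (count ?\<nu> i) :: nat)"
    by (rule prod.cong) auto
  moreover have "(\<Prod>i=2..n. fact (count ?\<nu> i) :: nat) = (\<Prod>i\<in>set_mset ?\<nu>. fact (count ?\<nu> i))"
    by (rule prod.mono_neutral_right) (use sub in \<open>auto simp: not_in_iff\<close>)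
  ultimately show ?thesis
    by (simp only: multinomial_def card_permutations_of_multiset)
qed

text \<open>The parts other than 1 fix \<open>\<alpha>\<close> up to order, and the sum
  \<open>n\<close> makes the deficit equal to the number of parts 1.\<close>

lemma bounded_lists_fibre:
  assumes "\<mu> \<in> partitions n"
  shows "{\<alpha> \<in> bounded_lists n. mset \<alpha> + replicate_mset (n - sum_list \<alpha>) 1 = \<mu>} =
    permutations_of_multiset (filter_mset (\<lambda>i. i \<noteq> 1) \<mu>)"
proof (intro set_eqI iffI)
  fix \<alpha>
  assume "\<alpha> \<in> {\<alpha> \<in> bounded_lists n. mset \<alpha> + replicate_mset (n - sum_list \<alpha>) 1 = \<mu>}"
  then have parts: "\<forall>i\<in>set \<alpha>. 2 \<le> i" and \<mu>: "\<mu> = mset \<alpha> + replicate_mset (n - sum_list \<alpha>) 1"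
    by (auto simp: bounded_lists_def)
  have "filter_mset (\<lambda>i. i \<noteq> 1) (mset \<alpha>) = mset \<alpha>"
    using parts by (auto simp: filter_mset_eq_conv)
  moreover have "filter_mset (\<lambda>i. i \<noteq> 1) (replicate_mset k 1) = {#}" for k :: nat
    by (induction k) auto
  ultimately show "\<alpha> \<in> permutations_of_multiset (filter_mset (\<lambda>i. i \<noteq> 1) \<mu>)"
    by (simp add: \<mu> permutations_of_multiset_def)
next
  fix \<alpha>
  assume "\<alpha> \<in> permutations_of_multiset (filter_mset (\<lambda>i. i \<noteq> 1) \<mu>)"
  then have \<alpha>: "mset \<alpha> = filter_mset (\<lambda>i. i \<noteq> 1) \<mu>" by (rule permutations_of_multisetD)
  have split: "\<mu> = mset \<alpha> + replicate_mset (count \<mu> 1) 1"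
    by (rule multiset_eqI) (auto simp: \<alpha>)
  have "sum_mset \<mu> = sum_list \<alpha> + count \<mu> 1"
    by (subst split) (simp add: sum_mset_sum_list)
  then have sum: "n = sum_list \<alpha> + count \<mu> 1"
    using assms by (simp add: partitions_def)
  have "2 \<le> i" if "i \<in> set \<alpha>" for i
  proof -
    have "i \<in># filter_mset (\<lambda>i. i \<noteq> 1) \<mu>" using that unfolding \<alpha> [symmetric] by simp
    then have "i \<noteq> 1" "i \<noteq> 0" using assms by (auto simp: partitions_def intro: gr0I)
    then show ?thesis by simp
  qed
  with sum split show "\<alpha> \<in> {\<alpha> \<in> bounded_lists n. mset \<alpha> + replicate_mset (n - sum_list \<alpha>) 1 = \<mu>}"
    by (auto simp: bounded_lists_def)
qed

theorem proposition4p3: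
  fixes n :: nat
  assumes "n \<ge> 4"
  shows "chromatic_sym_fun (path_graph n) =
    (\<Sum>\<mu>\<in>partitions n.
       (- 1) ^ count \<mu> 1
       * of_nat (multinomial (count \<mu>) {2..n})
       * of_nat ((n + count \<mu> 1 - (2 + size \<mu>)) choose count \<mu> 1)
       * star_sym_fun \<mu>)"
proof -
  let ?s = "\<lambda>k. chromatic_sym_fun (star_graph k)"
  let ?x = "- power_sum 1"
  let ?f = "\<lambda>\<alpha>. mset \<alpha> + replicate_mset (n - sum_list \<alpha>) 1"
  let ?c = "\<lambda>\<mu>. (- 1) ^ count \<mu> 1 * of_nat ((n + count \<mu> 1 - (2 + size \<mu>)) choose count \<mu> 1)
    * star_sym_fun \<mu>"
  have s1: "?s 1 = power_sum 1"
    using chromatic_star_graph_Suc [of 0] by (simp add: rooted_gf_0)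
  \<comment> \<open>Since \<open>?x\<close> is minus the star function of one vertex, its power
    supplies both the sign and the factors for the parts 1.\<close>
  have "term": "prod_list (map ?s \<alpha>) * ((1 - fps_const ?x * fps_X)
      * geometric_fps ?x ^ (\<Sum>i\<leftarrow>\<alpha>. i - 1)) $ (n - sum_list \<alpha>) = ?c (?f \<alpha>)"
    if "\<alpha> \<in> bounded_lists n" for \<alpha>
  proof -
    let ?m = "n - sum_list \<alpha>"
    have "count (mset \<alpha>) 1 = 0"
      using that by (auto simp: bounded_lists_def count_eq_zero_iff)
    then have count: "count (?f \<alpha>) 1 = ?m" by simp
    have "star_sym_fun (?f \<alpha>) = prod_list (map ?s \<alpha>) * power_sum 1 ^ ?m"
      using s1 by (simp add: star_sym_fun_def flip: prod_mset_prod_list)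
    then have "?c (?f \<alpha>) = prod_list (map ?s \<alpha>) * (of_nat ((n - (2 + length \<alpha>)) choose ?m) * ?x ^ ?m)"
      unfolding count power_minus [of "power_sum 1"] by (simp add: mult_ac)
    then show ?thesis
      using geometric_coefficient [OF assms that refl, of ?x] by simp
  qed
  have f: "?f ` bounded_lists n \<subseteq> partitions n"
    by (force simp: bounded_lists_def partitions_def sum_mset_sum_list split: if_splits)
  have "chromatic_sym_fun (path_graph n) = path_fps $ n"
    by (simp add: path_fps_def)
  also have "\<dots> = (\<Sum>\<alpha>\<in>bounded_lists n. prod_list (map ?s \<alpha>) * ((1 - fps_const ?x * fps_X)
      * geometric_fps ?x ^ (\<Sum>i\<leftarrow>\<alpha>. i - 1)) $ (n - sum_list \<alpha>))"
    using fps_fixpoint_expansion [OF path_fps_fixpoint, of ?s "geometric_fps ?x" 1 n]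
    by (simp add: star_fps_def)
  also have "\<dots> = (\<Sum>\<alpha>\<in>bounded_lists n. ?c (?f \<alpha>))"
    by (rule sum.cong [OF refl "term"])
  \<comment> \<open>The summand depends only on the partition \<open>?f \<alpha>\<close>, so each
    fibre contributes its cardinality.\<close>
  also have "\<dots> = (\<Sum>\<mu>\<in>partitions n. \<Sum>\<alpha>\<in>{\<alpha> \<in> bounded_lists n. ?f \<alpha> = \<mu>}. ?c (?f \<alpha>))"
    by (rule sum.group [symmetric]) (use f in \<open>auto simp: finite_partitions\<close>)
  also have "\<dots> = (\<Sum>\<mu>\<in>partitions n. of_nat (multinomial (count \<mu>) {2..n}) * ?c \<mu>)"
  proof (rule sum.cong [OF refl])
    fix \<mu> assume \<mu>: "\<mu> \<in> partitions n"
    have "(\<Sum>\<alpha>\<in>{\<alpha> \<in> bounded_lists n. ?f \<alpha> = \<mu>}. ?c (?f \<alpha>)) =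
        of_nat (card {\<alpha> \<in> bounded_lists n. ?f \<alpha> = \<mu>}) * ?c \<mu>"
      by simp
    then show "(\<Sum>\<alpha>\<in>{\<alpha> \<in> bounded_lists n. ?f \<alpha> = \<mu>}. ?c (?f \<alpha>)) =
        of_nat (multinomial (count \<mu>) {2..n}) * ?c \<mu>"
      by (simp only: bounded_lists_fibre [OF \<mu>] multinomial_eq_card_permutations [OF \<mu>])
  qed
  finally show ?thesis by (simp only: mult_ac)
qed

end
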